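(* For all integers $n\ge k\ge 1$ and all $t\ge 0$, the Weinstein functions have the closed form representation $$\Lambda_k^n(t)=\sum_{j=k}^n(-1)^{k+j}\binom{2j}{j-k}\binom{n+j+1}{n-j}\,e^{-jt},$$ and hence the derivatives of the de Branges functions have the closed form representation $$\dot\tau_k^n(t)=-k\sum_{j=k}^n(-1)^{k+j}\binom{2j}{j-k}\binom{n+j+1}{n-j}\,e^{-jt}.$$
   Context: $\mathbb{N}=\{1,2,3,\ldots\}$; a dot denotes the derivative with respect to $t$; $\mathbb{D}$ is the open unit disk in $\mathbb{C}$. De Branges functions: for fixed $n\in\mathbb{N}$, the functions $\tau_k^n:[0,\infty)\to\mathbb{R}$ $(k=1,\ldots,n+1)$ are the solution of the system of differential equations $$\tau_{k+1}^n(t)-\tau_k^n(t)=\frac{\dot\tau_k^n(t)}{k}+\frac{\dot\tau_{k+1}^n(t)}{k+1}\quad (k=1,\ldots,n),\qquad \tau_{n+1}^n\equiv 0,$$ with initial values $\tau_k^n(0)=n+1-k$. Weinstein functions: let $K(z)=\frac{z}{(1-z)^2}$ be the Koebe function, which is injective on $\mathbb{D}$, and for $z\in\mathbb{D}$, $t\ge 0$ let $w(z,t):=K^{-1}\big(e^{-t}K(z)\big)\in\mathbb{D}$ (i.e. $w(z,t)$ is the unique point of $\mathbb{D}$ with $K(w(z,t))=e^{-t}K(z)$). For $k\in\mathbb{N}$ the functions $\Lambda_k^n:[0,\infty)\to\mathbb{R}$ $(n\ge k)$ are defined as Taylor coefficients in $z$ by $$\frac{e^{t}\,w(z,t)^{k+1}}{1-w(z,t)^2}=\sum_{n=k}^{\infty}\Lambda_k^n(t)\,z^{n+1}\qquad(z\in\mathbb{D}).$$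 *)

theory Defs
  imports "HOL-Analysis.Analysis"
begin

definition koebe :: "complex \<Rightarrow> complex" where
  "koebe z = z / (1 - z)\<^sup>2"

definition koebe_flow :: "complex \<Rightarrow> real \<Rightarrow> complex" where
  "koebe_flow z t = the_inv_into (ball 0 1) koebe (of_real (exp (- t)) * koebe z)"

text \<open>
  The index \<open>m\<close> stands for \<open>n - k\<close>; the values of \<open>Weinstein k n\<close> are meaningful
  for \<open>n \<ge> k \<ge> 1\<close> and nonnegative times only.
\<close>
definition Weinstein :: "nat \<Rightarrow> nat \<Rightarrow> real \<Rightarrow> real" where
  "Weinstein k n t =
    (THE c :: nat \<Rightarrow> real. \<forall>z\<in>ball (0::complex) 1.
       (\<lambda>m. of_real (c m) * z ^ (k + m + 1)) sums
         (of_real (exp t) * koebe_flow z t ^ (k + 1) / (1 - (koebe_flow z t)\<^sup>2))) (n - k)"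

text \<open>The derivative at time 0 is the one-sided one.\<close>
definition de_Branges_system :: "nat \<Rightarrow> (nat \<Rightarrow> real \<Rightarrow> real) \<Rightarrow> bool" where
  "de_Branges_system n \<tau> \<longleftrightarrow>
    (\<exists>\<tau>'. (\<forall>k\<in>{1..n+1}. \<forall>t\<in>{0..}. (\<tau> k has_real_derivative \<tau>' k t) (at t within {0..})) \<and>
      (\<forall>k\<in>{1..n}. \<forall>t\<in>{0..}.
         \<tau> (k + 1) t - \<tau> k t = \<tau>' k t / real k + \<tau>' (k + 1) t / real (k + 1))) \<and>
    (\<forall>t\<in>{0..}. \<tau> (n + 1) t = 0) \<and>
    (\<forall>k\<in>{1..n+1}. \<tau> k 0 = real (n + 1 - k))"

text \<open>
  Extensionality makes the solution unique as a HOL function: it has no freedom outside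
  the index range and outside \<open>[0,\<infinity>)\<close>.
\<close>
definition de_Branges :: "nat \<Rightarrow> nat \<Rightarrow> real \<Rightarrow> real" where
  "de_Branges n =
    (THE \<tau>. \<tau> \<in> {1..n+1} \<rightarrow>\<^sub>E ({0..} \<rightarrow>\<^sub>E UNIV) \<and> de_Branges_system n \<tau>)"

end

(* With x = e^{-t} K(z) and s = sqrt (1 + 4 x), the flow is w = (s - 1) / (s + 1), and the
   generating function becomes e^t w^{k+1} / (1 - w^2) = K(z) w^k / s.  As power series in x,
   the functions G_k = w^k / s satisfy G_{k+1} = x (G_k - 2 G_{k+1} + G_{k+2}), because
   w = x (1 - w)^2; together with G_0 = (1 + 4 x)^{-1/2} this determines them, and the signed
   binomials (2j choose j-k) obey the same recursion.  Substituting the powers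
   K(z)^{j+1} = z^{j+1} (1 - z)^{-2j-2} gives the formula near 0, and holomorphy of the flow
   extends the expansion to the disk.

   For the de Branges functions, the system reduces to a two-term identity between the
   coefficients of e^{-jt}.  The initial values telescope, because at t = 0 the flow is the
   identity and z^{k+1} / (1 - z^2) has coefficients 1, 0, 1, 0, ...  Solutions are unique by
   descending induction on k: the difference d of two solutions satisfies d' = - k d once it
   vanishes at k + 1. *)
theory Submission
  imports Defs "HOL-Complex_Analysis.Laurent_Convergence"
begin

unbundle no vec_syntax

section \<open>Formal power series\<close>

text \<open>The expansion of \<open>w ^ k / sqrt (1 + 4 * x)\<close> in powers of \<open>x = w / (1 - w)\<^sup>2\<close>.\<close>
definition central_fps :: "nat \<Rightarrow> complex fps" where
  "central_fps k = Abs_fps (\<lambda>j. if j < k then 0 else (-1) ^ (k + j) * of_nat ((2 * j) choose (j - k)))"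

text \<open>At X^(j+1) this is Pascal's rule applied twice: C(2j+2, j-k) = C(2j, j-k) + 2 C(2j,
  j-k-1) + C(2j, j-k-2). The alternating sign turns +2 into -2.\<close>

lemma central_fps_rec:
  "central_fps (Suc k) = fps_X * (central_fps k - 2 * central_fps (Suc k) + central_fps (Suc (Suc k)))"
proof (rule fps_ext)
  fix i
  show "central_fps (Suc k) $ i = (fps_X * (central_fps k - 2 * central_fps (Suc k) + central_fps (Suc (Suc k)))) $ i"
  proof (cases i)
    case 0 then show ?thesis by (simp add: central_fps_def)
  next
    case (Suc j)
    \<comment> \<open>Up to j = k + 1 some summands are 0 by definition; from k + 2 on all three
      binomials are genuine.\<close>
    consider "j < k" | "j = k" | "j = Suc k" | m where "j = Suc (Suc k) + m"
      by (metis add_Suc_right less_iff_Suc_add not_less_eq less_antisym linorder_neqE_nat less_Suc_eq add_Suc)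
    then show ?thesis
      by cases (auto simp: Suc central_fps_def numeral_fps_const algebra_simps)
  qed
qed

text \<open>This ratio of consecutive coefficients becomes the differential equation of their
  generating series.\<close>

lemma central_binomial_rec: "Suc j * ((2 * Suc j) choose Suc j) = 2 * (2 * j + 1) * ((2 * j) choose j)"
proof -
  have "Suc j * ((2 * Suc j) choose Suc j) = (2 * Suc j) * (Suc (2 * j) choose j)"
    using Suc_times_binomial_eq[of "Suc (2*j)" j] by (simp add: algebra_simps)
  also have "Suc (2 * j) choose j = Suc (2 * j) choose Suc j"
    using binomial_symmetric[of j "Suc (2*j)"] by simp
  also have "(2 * Suc j) * (Suc (2 * j) choose Suc j) = 2 * (Suc j * (Suc (2 * j) choose Suc j))"
    by simp
  also have "Suc j * (Suc (2 * j) choose Suc j) = Suc (2 * j) * ((2 * j) choose j)"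
    using Suc_times_binomial_eq[of "2*j" j] by (simp add: algebra_simps)
  finally show ?thesis by simp
qed

text \<open>Identifies \<open>central_fps 0\<close> as (1 + 4 X)^(-1/2): the equation F' (1 + 4 X) =
  -2 F makes the derivative of F^2 (1 + 4 X) vanish, and the constant coefficient is 1.\<close>

lemma central_fps_0_square: "central_fps 0 ^ 2 * (1 + 4 * fps_X) = 1"
proof -
  let ?F = "central_fps 0"
  have ode: "fps_deriv ?F * (1 + 4 * fps_X) = - 2 * ?F"
  proof (rule fps_ext)
    fix i
    have F: "?F $ j = (-1) ^ j * of_nat ((2 * j) choose j)" for j
      by (simp add: central_fps_def)
    have *: "of_nat (Suc j) * ?F $ Suc j = - 2 * (2 * of_nat j + 1) * ?F $ j" for j
    proof -
      have "of_nat (Suc j) * ?F $ Suc j = - ((-1) ^ j * of_nat (Suc j * ((2 * Suc j) choose Suc j)))"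
        unfolding F of_nat_mult by simp
      also have "\<dots> = - 2 * (2 * of_nat j + 1) * ?F $ j"
        unfolding F central_binomial_rec of_nat_mult by (simp add: algebra_simps)
      finally show ?thesis .
    qed
    show "(fps_deriv ?F * (1 + 4 * fps_X)) $ i = (- 2 * ?F) $ i"
    proof (cases i)
      case 0
      then show ?thesis using *[of 0] by (simp add: numeral_fps_const algebra_simps)
    next
      case (Suc j)
      have "(fps_deriv ?F * (1 + 4 * fps_X)) $ i = of_nat (Suc i) * ?F $ Suc i + 4 * (of_nat (Suc j) * ?F $ Suc j)"
        by (simp add: Suc numeral_fps_const algebra_simps)
      also have "of_nat (Suc i) * ?F $ Suc i = - 2 * (2 * of_nat i + 1) * ?F $ i" by (rule *)
      finally show ?thesis by (simp add: Suc numeral_fps_const algebra_simps)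
    qed
  qed
  have "fps_deriv (?F ^ 2 * (1 + 4 * fps_X)) = 2 * ?F * (fps_deriv ?F * (1 + 4 * fps_X)) + 4 * ?F ^ 2"
    by (simp add: power2_eq_square numeral_fps_const algebra_simps)
  also have "\<dots> = 0" unfolding ode by (simp add: power2_eq_square algebra_simps)
  finally have "?F ^ 2 * (1 + 4 * fps_X) = fps_const ((?F ^ 2 * (1 + 4 * fps_X)) $ 0)"
    by (simp only: fps_deriv_eq_0_iff)
  also have "(?F ^ 2 * (1 + 4 * fps_X)) $ 0 = 1"
    by (simp add: central_fps_def power2_eq_square)
  finally show ?thesis by simp
qed

text \<open>Multiplying by \<open>X\<close> raises the order, so all coefficients vanish by induction on their index.\<close>
lemma fps_rec_eq_0:
  fixes D :: "nat \<Rightarrow> 'a :: comm_ring_1 fps"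
  assumes "X $ 0 = 0" "D 0 = 0"
    and rec: "\<And>k. D (Suc k) = X * (D k - 2 * D (Suc k) + D (Suc (Suc k)))"
  shows "D k = 0"
proof -
  have "\<forall>k. D k $ n = 0" for n
  proof (induction n rule: less_induct)
    case (less n)
    show ?case
    proof
      fix k
      show "D k $ n = 0"
      proof (cases k)
        case (Suc k')
        let ?E = "D k' - 2 * D (Suc k') + D (Suc (Suc k'))"
        have "D k $ n = (\<Sum>i=0..n. X $ i * ?E $ (n - i))"
          unfolding Suc by (subst rec) (rule fps_mult_nth)
        also have "\<dots> = 0"
        proof (rule sum.neutral, rule ballI)
          fix i assume "i \<in> {0..n}"
          show "X $ i * ?E $ (n - i) = 0"
            using assms(1) less \<open>i \<in> {0..n}\<close> by (cases "i = 0") (auto simp: numeral_fps_const)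
        qed
        finally show ?thesis .
      qed (use assms in auto)
    qed
  qed
  then show ?thesis by (simp add: fps_eq_iff)
qed

text \<open>Meant for the expansions X, S and W of e^(-t) K(z), the root s and the flow w. Both
  sides obey the recursion of \<open>central_fps_rec\<close> with X as the variable and agree at k =
  0, so \<open>fps_rec_eq_0\<close> applies to their difference.\<close>

lemma central_fps_compose:
  assumes X: "X $ 0 = 0" and S: "S ^ 2 = 1 + 4 * X" "S $ 0 = 1" and W: "W = X * (1 - W) ^ 2"
  shows "W ^ k * inverse S = central_fps k oo X"
proof -
  let ?C = "\<lambda>k. central_fps k oo X"
  have "((central_fps 0 ^ 2 * (1 + 4 * fps_X)) oo X) = 1"
    by (simp add: central_fps_0_square)
  then have "?C 0 ^ 2 * S ^ 2 = 1"
    unfolding S fps_compose_mult_distrib[OF X] fps_compose_power[OF X, symmetric] fps_compose_add_distrib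
    using X by simp
  \<comment> \<open>The squares determine the root up to sign; the second factor has constant
    coefficient 2, so the first one vanishes.\<close>
  then have "(?C 0 * S - 1) * (?C 0 * S + 1) = 0"
    by (simp add: algebra_simps power2_eq_square)
  moreover have "(?C 0 * S + 1) $ 0 \<noteq> 0"
    using S by (simp add: central_fps_def)
  moreover from this have "?C 0 * S + 1 \<noteq> 0" by (metis fps_zero_nth)
  ultimately have "?C 0 * S = 1" by simp
  then have inv: "?C 0 = inverse S"
    by (metis fps_inverse_unique mult.commute)
  have rec: "?C (Suc k) = X * (?C k - 2 * ?C (Suc k) + ?C (Suc (Suc k)))" for k
  proof -
    have "?C (Suc k) = (fps_X * (central_fps k - 2 * central_fps (Suc k) + central_fps (Suc (Suc k)))) oo X"
      by (subst central_fps_rec) (rule refl)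
    then show ?thesis
      by (simp add: X fps_compose_mult_distrib fps_compose_add_distrib fps_compose_sub_distrib)
  qed
  have "W ^ k * inverse S - ?C k = 0" for k
  proof (rule fps_rec_eq_0[OF X, of "\<lambda>k. W ^ k * inverse S - ?C k"])
    fix k
    have "W ^ Suc k * inverse S = W * (W ^ k * inverse S)" by simp
    also have "\<dots> = X * (1 - W) ^ 2 * (W ^ k * inverse S)" by (subst W) simp
    finally show "W ^ Suc k * inverse S - ?C (Suc k) =
      X * (W ^ k * inverse S - ?C k - 2 * (W ^ Suc k * inverse S - ?C (Suc k)) + (W ^ Suc (Suc k) * inverse S - ?C (Suc (Suc k))))"
      using rec[of k] by (simp add: algebra_simps power2_eq_square)
  qed (simp add: inv)
  then show ?thesis by simp
qed

section \<open>Powers of the Koebe series\<close>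

definition koebe_fps :: "complex fps" where
  "koebe_fps = fps_X * inverse ((1 - fps_X) ^ 2)"

text \<open>K(z)^(j+1) = z^(j+1) (1 - z)^(-2j-2), and in the negative binomial series z^(n-j) has
  the coefficient C(2j+2 + (n-j) - 1, n-j).\<close>

lemma koebe_fps_power_nth:
  assumes "j \<le> n"
  shows "(fps_const a * koebe_fps) ^ Suc j $ Suc n = a ^ Suc j * of_nat ((n + j + 1) choose (n - j))"
proof -
  have "(fps_const a * koebe_fps) ^ Suc j = fps_const (a ^ Suc j) * (fps_X ^ Suc j * inverse ((1 - fps_X) ^ (2 * Suc j)))"
    unfolding koebe_fps_def power_mult_distrib fps_inverse_power power_mult fps_const_power by simp
  also have "\<dots> $ Suc n = a ^ Suc j * inverse ((1 - fps_X) ^ (2 * Suc j)) $ (n - j)"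
    using assms by (simp only: fps_mult_left_const_nth fps_X_power_mult_nth) simp
  also have "inverse ((1 - fps_X) ^ (2 * Suc j)) $ (n - j) = (of_nat ((n + j + 1) choose (n - j)) :: complex)"
  proof -
    have *: "2 * Suc j + (n - j) - 1 = n + j + 1" using assms by simp
    show ?thesis
      using arg_cong[OF one_minus_const_fps_X_neg_power'[of "2 * Suc j" "1 :: complex"], of "\<lambda>F. F $ (n - j)"]
      unfolding fps_nth_Abs_fps * by (simp del: mult_Suc_right power_Suc)
  qed
  finally show ?thesis .
qed

text \<open>For a = e^(-t) this is the coefficient of z^(n+1) in K(z) w^k / s; the factor 1 / a
  turns a K(z) back into K(z). Only the powers j + 1 with k \<le> j \<le> n contribute.\<close>

lemma koebe_central_nth:
  assumes "a \<noteq> 0"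
  shows "(fps_const (inverse a) * ((fps_const a * koebe_fps) * (central_fps k oo (fps_const a * koebe_fps)))) $ Suc n
    = (\<Sum>j=k..n. (-1) ^ (k + j) * of_nat ((2 * j) choose (j - k)) * of_nat ((n + j + 1) choose (n - j)) * a ^ j)"
proof -
  let ?X = "fps_const a * koebe_fps"
  have X: "?X $ 0 = 0" by (simp add: koebe_fps_def)
  have "(?X * (central_fps k oo ?X)) $ Suc n = ((fps_X * central_fps k) oo ?X) $ Suc n"
    using X by (simp only: fps_compose_mult_distrib[OF X] fps_X_fps_compose_startby0)
  also have "\<dots> = (\<Sum>i=0..Suc n. (fps_X * central_fps k) $ i * ?X ^ i $ Suc n)"
    by (rule fps_compose_nth)
  also have "\<dots> = (\<Sum>j=0..n. central_fps k $ j * ?X ^ Suc j $ Suc n)"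
    by (subst sum.atLeast0_atMost_Suc_shift) (simp del: power_Suc)
  also have "\<dots> = (\<Sum>j=0..n. central_fps k $ j * (a ^ Suc j * of_nat ((n + j + 1) choose (n - j))))"
    by (intro sum.cong refl arg_cong2[where f = "(*)"] koebe_fps_power_nth) auto
  also have "\<dots> = (\<Sum>j=k..n. central_fps k $ j * (a ^ Suc j * of_nat ((n + j + 1) choose (n - j))))"
    by (rule sum.mono_neutral_right) (auto simp: central_fps_def)
  also have "\<dots> = (\<Sum>j=k..n. a * ((-1) ^ (k + j) * of_nat ((2 * j) choose (j - k)) * of_nat ((n + j + 1) choose (n - j)) * a ^ j))"
    by (intro sum.cong refl) (auto simp: central_fps_def)
  also have "\<dots> = a * (\<Sum>j=k..n. (-1) ^ (k + j) * of_nat ((2 * j) choose (j - k)) * of_nat ((n + j + 1) choose (n - j)) * a ^ j)"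
    by (simp only: sum_distrib_left)
  finally show ?thesis using assms by simp
qed

section \<open>Weinstein functions\<close>

text \<open>z (1 - w)^2 - w (1 - z)^2 = (z - w) (1 - z w), and |z w| < 1 keeps the second factor
  away from 0.\<close>

lemma koebe_inj_on: "inj_on koebe (ball 0 1)"
proof (rule inj_onI)
  fix z w :: complex
  assume "z \<in> ball 0 1" "w \<in> ball 0 1" and eq: "koebe z = koebe w"
  then have n: "norm z < 1" "norm w < 1" by auto
  then have "z \<noteq> 1" "w \<noteq> 1" by auto
  with eq have "z * (1 - w)\<^sup>2 = w * (1 - z)\<^sup>2"
    by (simp add: koebe_def field_simps)
  then have "(z - w) * (1 - z * w) = 0" by (simp add: power2_eq_square algebra_simps)
  moreover have "norm (z * w) < 1 * 1"
    unfolding norm_mult by (intro mult_strict_mono n) auto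
  ultimately show "z = w" by auto
qed

text \<open>The s in w = (s - 1) / (s + 1). The principal root selects the value inside the disk;
  the other root would give 1 / w.\<close>

definition flow_root :: "real \<Rightarrow> complex \<Rightarrow> complex" where
  "flow_root t z = csqrt (1 + 4 * (of_real (exp (- t)) * koebe z))"

text \<open>1 + 4 K(z) = u^2 with u = (1 + z) / (1 - z) in the right half-plane, so u^2 lies in the
  slit plane. The radicand is on the segment from 1 to u^2, and the slit plane is star-shaped about
  1.\<close>

lemma flow_radicand_not_nonpos:
  assumes "norm z < 1" "0 \<le> t"
  shows "1 + 4 * (of_real (exp (- t)) * koebe z) \<notin> \<real>\<^sub>\<le>\<^sub>0"
proof
  define u where "u = (1 + z) / (1 - z)"
  have "z \<noteq> 1" using assms by auto
  then have K: "1 + 4 * koebe z = u\<^sup>2"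
    by (simp add: koebe_def u_def field_simps) (simp add: power2_eq_square algebra_simps)
  define a where "a = exp (- t)"
  have a: "0 < a" "a \<le> 1" using assms by (auto simp: a_def)
  assume "1 + 4 * (of_real (exp (- t)) * koebe z) \<in> \<real>\<^sub>\<le>\<^sub>0"
  moreover have "1 + 4 * (of_real (exp (- t)) * koebe z) = of_real (1 - a) + of_real a * (1 + 4 * koebe z)"
    by (simp add: a_def algebra_simps)
  ultimately have "of_real (1 - a) + of_real a * u\<^sup>2 \<in> \<real>\<^sub>\<le>\<^sub>0" by (simp add: K)
  then have im: "a * Im (u\<^sup>2) = 0" and re: "1 - a + a * Re (u\<^sup>2) \<le> 0"
    by (auto simp: complex_nonpos_Reals_iff)
  have "Re u > 0"
  proof -
    have "u = (1 + z) * cnj (1 - z) / of_real ((norm (1 - z))\<^sup>2)"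
      unfolding u_def by (rule complex_div_cnj)
    moreover have "Re ((1 + z) * cnj (1 - z)) = 1 - (norm z)\<^sup>2"
      unfolding cmod_power2 by (simp add: power2_eq_square algebra_simps)
    moreover have "(norm z)\<^sup>2 < 1" using assms by (simp add: abs_square_less_1)
    ultimately show ?thesis using \<open>z \<noteq> 1\<close> by simp
  qed
  with im a have "Im u = 0" by (simp add: power2_eq_square)
  then have "Re (u\<^sup>2) > 0" using \<open>Re u > 0\<close> by (simp add: power2_eq_square)
  then have "a * Re (u\<^sup>2) > 0" using a by simp
  with re a show False by linarith
qed

lemma flow_root_square: "(flow_root t z)\<^sup>2 = 1 + 4 * (of_real (exp (- t)) * koebe z)"
  by (simp add: flow_root_def)

lemma Re_flow_root_pos:
  assumes "norm z < 1" "0 \<le> t"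
  shows "Re (flow_root t z) > 0"
proof (rule ccontr)
  assume "\<not> Re (flow_root t z) > 0"
  then have "Re (flow_root t z) = 0"
    using csqrt_principal[of "1 + 4 * (of_real (exp (- t)) * koebe z)"] by (auto simp: flow_root_def)
  then have "(flow_root t z)\<^sup>2 \<in> \<real>\<^sub>\<le>\<^sub>0"
    by (simp add: complex_nonpos_Reals_iff power2_eq_square)
  with flow_radicand_not_nonpos[OF assms] show False by (simp add: flow_root_square)
qed

text \<open>Re s > 0 puts (s - 1) / (s + 1) in the disk, and its image under K is (s^2 - 1) / 4 =
  e^(-t) K(z); injectivity does the rest.\<close>

lemma koebe_flow_eq:
  assumes "norm z < 1" "0 \<le> t"
  shows "koebe_flow z t = (flow_root t z - 1) / (flow_root t z + 1)"
proof -
  let ?s = "flow_root t z"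
  let ?w = "(?s - 1) / (?s + 1)"
  have s: "Re ?s > 0" by (rule Re_flow_root_pos[OF assms])
  then have ne: "?s + 1 \<noteq> 0" by (auto simp: complex_eq_iff)
  have "(norm (?s - 1))\<^sup>2 < (norm (?s + 1))\<^sup>2"
    using s unfolding cmod_power2 by (simp add: power2_eq_square algebra_simps)
  then have "norm (?s - 1) < norm (?s + 1)" by (simp add: power2_less_imp_less)
  then have w: "?w \<in> ball 0 1" using ne by (simp add: norm_divide)
  have "1 - ?w = 2 / (?s + 1)" using ne by (simp add: field_simps)
  then have "koebe ?w = (?s - 1) / (?s + 1) / (2 / (?s + 1))\<^sup>2" by (simp add: koebe_def)
  also have "\<dots> = (?s\<^sup>2 - 1) / 4"
  proof -
    have "(q - 1 - 1) / q / (2 / q)\<^sup>2 = ((q - 1)\<^sup>2 - 1) / 4" if "q \<noteq> 0" for q :: complex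
      using that by (simp add: field_simps power2_eq_square)
    from this[OF ne] show ?thesis by simp
  qed
  also have "\<dots> = of_real (exp (- t)) * koebe z" by (simp add: flow_root_square)
  finally show ?thesis
    unfolding koebe_flow_def using the_inv_into_f_f[OF koebe_inj_on w] by simp
qed

text \<open>The first equation holds because w / (1 - w^2) = (s^2 - 1) / (4 s) and e^t (s^2 - 1) / 4
  = K(z). The second is K(w) = e^(-t) K(z) cleared of its denominator, as the formal series need
  it.\<close>

lemma koebe_flow_gen_eq:
  assumes "norm z < 1" "0 \<le> t"
  defines "w \<equiv> koebe_flow z t"
  shows "of_real (exp t) * w ^ (k + 1) / (1 - w\<^sup>2) = koebe z * (w ^ k * inverse (flow_root t z))"
    and "w = of_real (exp (- t)) * koebe z * (1 - w)\<^sup>2"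
proof -
  let ?s = "flow_root t z"
  have s: "Re ?s > 0" by (rule Re_flow_root_pos[OF assms(1,2)])
  then have ne: "?s + 1 \<noteq> 0" "?s \<noteq> 0" by (auto simp: complex_eq_iff)
  have w: "w = (?s - 1) / (?s + 1)" unfolding w_def by (rule koebe_flow_eq[OF assms(1,2)])
  have K: "koebe z = of_real (exp t) * (?s\<^sup>2 - 1) / 4"
    by (simp add: flow_root_square exp_minus field_simps)
  have 1: "1 - w = 2 / (?s + 1)" "1 - w\<^sup>2 = 4 * ?s / (?s + 1)\<^sup>2"
    using ne by (simp_all add: w divide_simps) (simp add: power2_eq_square algebra_simps)
  have "w = (?s\<^sup>2 - 1) / 4 * (1 - w)\<^sup>2"
  proof -
    have "(q - 1 - 1) / q = ((q - 1)\<^sup>2 - 1) / 4 * (2 / q)\<^sup>2" if "q \<noteq> 0" for q :: complex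
      using that by (simp add: field_simps power2_eq_square)
    from this[OF ne(1)] show ?thesis unfolding 1 unfolding w by simp
  qed
  then show "w = of_real (exp (- t)) * koebe z * (1 - w)\<^sup>2" by (simp add: flow_root_square)
  have "of_real (exp t) * w ^ (k + 1) / (1 - w\<^sup>2) = of_real (exp t) * w ^ k * (w / (1 - w\<^sup>2))" by simp
  also have "w / (1 - w\<^sup>2) = (?s\<^sup>2 - 1) / 4 * inverse ?s"
  proof -
    have "(p - 1) / q / (4 * p / q\<^sup>2) = (p - 1) * q / 4 * inverse p" if "p \<noteq> 0" "q \<noteq> 0" for p q :: complex
      using that by (simp add: field_simps power2_eq_square)
    from this[OF ne(2,1)] show ?thesis
      unfolding 1 unfolding w by (simp add: power2_eq_square algebra_simps)
  qed
  finally show "of_real (exp t) * w ^ (k + 1) / (1 - w\<^sup>2) = koebe z * (w ^ k * inverse ?s)"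
    by (simp add: K)
qed

section \<open>Holomorphy and Taylor expansion on the disk\<close>

lemma koebe_holomorphic: "koebe holomorphic_on ball 0 1"
  unfolding koebe_def by (intro holomorphic_intros) auto

lemma flow_root_holomorphic:
  assumes "0 \<le> t"
  shows "flow_root t holomorphic_on ball 0 1"
  unfolding flow_root_def
  by (intro holomorphic_intros koebe_holomorphic) (use flow_radicand_not_nonpos assms in auto)

lemma koebe_flow_holomorphic:
  assumes "0 \<le> t"
  shows "(\<lambda>z. koebe_flow z t) holomorphic_on ball 0 1"
proof -
  have "flow_root t z + 1 \<noteq> 0" if "z \<in> ball 0 1" for z
    using Re_flow_root_pos[of z t] that assms by (auto simp: complex_eq_iff)
  then have "(\<lambda>z. (flow_root t z - 1) / (flow_root t z + 1)) holomorphic_on ball 0 1"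
    by (intro holomorphic_intros flow_root_holomorphic assms)
  then show ?thesis
    by (rule holomorphic_transform) (use koebe_flow_eq assms in auto)
qed

lemma koebe_has_fps_expansion: "koebe has_fps_expansion koebe_fps"
proof -
  have "(\<lambda>z. z * inverse ((1 - z) ^ 2)) has_fps_expansion koebe_fps"
    unfolding koebe_fps_def by (intro fps_expansion_intros) auto
  then show ?thesis by (simp add: koebe_def [abs_def] divide_inverse)
qed

lemma has_fps_expansion_transform:
  assumes "f has_fps_expansion F" and "eventually (\<lambda>z. f z = g z) (nhds 0)"
  shows "g has_fps_expansion F"
  using assms(1) has_fps_expansion_cong[OF assms(2) refl] by simp

text \<open>For n < k the sum is empty and the value 0; the index shift in the Taylor series and the
  case k = n of the initial values rely on this.\<close>

definition Weinstein_poly :: "nat \<Rightarrow> nat \<Rightarrow> real \<Rightarrow> real" where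
  "Weinstein_poly k n t = (\<Sum>j=k..n. (-1) ^ (k + j) * real ((2 * j) choose (j - k))
              * real ((n + j + 1) choose (n - j)) * exp (- (real j * t)))"

definition Weinstein_gen :: "nat \<Rightarrow> real \<Rightarrow> complex \<Rightarrow> complex" where
  "Weinstein_gen k t z = of_real (exp t) * koebe_flow z t ^ (k + 1) / (1 - (koebe_flow z t)\<^sup>2)"

text \<open>In the form K w^k / s the only new denominator is s, and Re s > 0.\<close>

lemma Weinstein_gen_holomorphic:
  assumes "0 \<le> t"
  shows "Weinstein_gen k t holomorphic_on ball 0 1"
proof -
  have "flow_root t z \<noteq> 0" if "z \<in> ball 0 1" for z
    using Re_flow_root_pos[of z t] that assms by (auto simp: complex_eq_iff)
  then have "(\<lambda>z. koebe z * (koebe_flow z t ^ k * inverse (flow_root t z))) holomorphic_on ball 0 1"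
    by (intro holomorphic_intros flow_root_holomorphic koebe_flow_holomorphic koebe_holomorphic assms)
  then show ?thesis
    by (rule holomorphic_transform) (use koebe_flow_gen_eq(1) assms in \<open>auto simp: Weinstein_gen_def\<close>)
qed

text \<open>Uniqueness of expansions turns the functional equations for s and w into the equations
  between formal series that \<open>central_fps_compose\<close> assumes;
  \<open>koebe_central_nth\<close> then reads off the coefficients.\<close>

lemma Weinstein_gen_expansion:
  assumes "0 \<le> t"
  shows "Weinstein_gen k t has_fps_expansion Abs_fps (\<lambda>m. case m of 0 \<Rightarrow> 0 | Suc n \<Rightarrow> of_real (Weinstein_poly k n t))"
proof -
  have ev: "eventually (\<lambda>z::complex. z \<in> ball 0 1) (nhds 0)" by (intro eventually_nhds_in_open) auto
  define a :: complex where "a = of_real (exp (- t))"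
  have a: "a \<noteq> 0" by (simp add: a_def)
  define X where "X = fps_const a * koebe_fps"
  define S where "S = fps_expansion (flow_root t) 0"
  define W where "W = fps_expansion (\<lambda>z. koebe_flow z t) 0"
  have X0: "X $ 0 = 0" by (simp add: X_def koebe_fps_def)
  have X: "(\<lambda>z. a * koebe z) has_fps_expansion X"
    unfolding X_def by (intro fps_expansion_intros koebe_has_fps_expansion)
  have S: "flow_root t has_fps_expansion S"
    unfolding S_def by (rule has_fps_expansion_fps_expansion[of "ball 0 1"]) (use flow_root_holomorphic assms in auto)
  have W: "(\<lambda>z. koebe_flow z t) has_fps_expansion W"
    unfolding W_def by (rule has_fps_expansion_fps_expansion[of "ball 0 1"]) (use koebe_flow_holomorphic assms in auto)
  have "(\<lambda>z. flow_root t z ^ 2) has_fps_expansion S ^ 2"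
    by (intro fps_expansion_intros S)
  moreover have "(\<lambda>z. flow_root t z ^ 2) has_fps_expansion 1 + 4 * X"
    unfolding flow_root_square a_def[symmetric] by (intro fps_expansion_intros X)
  ultimately have S2: "S ^ 2 = 1 + 4 * X" by (rule fps_expansion_unique_complex)
  have S0: "S $ 0 = 1"
    by (simp add: S_def fps_expansion_def flow_root_def koebe_def)
  have "(\<lambda>z. a * koebe z * (1 - koebe_flow z t) ^ 2) has_fps_expansion X * (1 - W) ^ 2"
    by (intro fps_expansion_intros X W)
  moreover have "eventually (\<lambda>z. a * koebe z * (1 - koebe_flow z t) ^ 2 = koebe_flow z t) (nhds 0)"
    using ev by eventually_elim (use koebe_flow_gen_eq(2) assms in \<open>auto simp: a_def\<close>)
  ultimately have "(\<lambda>z. koebe_flow z t) has_fps_expansion X * (1 - W) ^ 2"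
    by (rule has_fps_expansion_transform)
  with W have W2: "W = X * (1 - W) ^ 2" by (rule fps_expansion_unique_complex)
  have "(\<lambda>z. koebe z * (koebe_flow z t ^ k * inverse (flow_root t z))) has_fps_expansion
     koebe_fps * (W ^ k * inverse S)"
    by (intro fps_expansion_intros koebe_has_fps_expansion W S) (simp add: S0)
  moreover have "eventually (\<lambda>z. koebe z * (koebe_flow z t ^ k * inverse (flow_root t z)) = Weinstein_gen k t z) (nhds 0)"
    using ev by eventually_elim (use koebe_flow_gen_eq(1) assms in \<open>auto simp: Weinstein_gen_def\<close>)
  ultimately have "Weinstein_gen k t has_fps_expansion koebe_fps * (W ^ k * inverse S)"
    by (rule has_fps_expansion_transform)
  also have "W ^ k * inverse S = central_fps k oo X"
    by (rule central_fps_compose[OF X0 S2 S0 W2])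
  also have "koebe_fps = fps_const (inverse a) * X"
  proof -
    have "fps_const (inverse a) * X = fps_const (inverse a * a) * koebe_fps"
      unfolding X_def by (simp only: fps_const_mult[symmetric] mult.assoc)
    then show ?thesis using a by simp
  qed
  also have "fps_const (inverse a) * X * (central_fps k oo X) = Abs_fps (\<lambda>m. case m of 0 \<Rightarrow> 0 | Suc n \<Rightarrow> of_real (Weinstein_poly k n t))"
  proof (rule fps_ext)
    fix m
    show "(fps_const (inverse a) * X * (central_fps k oo X)) $ m = Abs_fps (\<lambda>m. case m of 0 \<Rightarrow> 0 | Suc n \<Rightarrow> of_real (Weinstein_poly k n t)) $ m"
    proof (cases m)
      case 0
      then show ?thesis by (simp add: X0)
    next
      case (Suc n)
      have pw: "a ^ j = of_real (exp (- (real j * t)))" for j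
        unfolding a_def of_real_power[symmetric] exp_of_nat_mult[symmetric] by simp
      have "(fps_const (inverse a) * X * (central_fps k oo X)) $ m =
        (\<Sum>j=k..n. (-1) ^ (k + j) * of_nat ((2 * j) choose (j - k)) * of_nat ((n + j + 1) choose (n - j)) * a ^ j)"
        using koebe_central_nth[OF a, of k n] unfolding X_def Suc by (simp only: mult.assoc)
      also have "\<dots> = of_real (Weinstein_poly k n t)"
        unfolding Weinstein_poly_def of_real_sum by (intro sum.cong refl) (simp add: pw)
      finally show ?thesis by (simp add: Suc)
    qed
  qed
  finally show ?thesis .
qed

text \<open>Holomorphy on the whole disk makes the Taylor series converge to the function there, not
  only near 0.\<close>

lemma Weinstein_gen_sums:
  assumes "0 \<le> t" "norm z < 1"
  shows "(\<lambda>m. of_real (Weinstein_poly k (k + m) t) * z ^ (k + m + 1)) sums Weinstein_gen k t z"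
proof -
  let ?c = "\<lambda>m. case m of 0 \<Rightarrow> 0 | Suc n \<Rightarrow> complex_of_real (Weinstein_poly k n t)"
  have "(\<lambda>m. Abs_fps ?c $ m * z ^ m) sums Weinstein_gen k t z"
    by (rule has_fps_expansion_imp_sums_complex[OF Weinstein_gen_expansion, of _ _ "ereal 1"])
       (use assms Weinstein_gen_holomorphic in \<open>auto simp only: eball_ereal less_ereal.simps\<close>)
  \<comment> \<open>The coefficients of z^0, ..., z^k vanish: the first by definition, the others as
    empty sums.\<close>
  then have "(\<lambda>m. ?c (m + (k + 1)) * z ^ (m + (k + 1))) sums Weinstein_gen k t z"
    by (subst sums_zero_iff_shift) (auto simp: Weinstein_poly_def split: nat.splits)
  then show ?thesis by (simp add: add_ac)
qed

text \<open>Convergence on the disk makes the shifted sequence a Taylor expansion at 0. This is the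
  uniqueness behind the description in \<open>Weinstein\<close>, and it also evaluates the closed
  form at t = 0.\<close>

lemma Weinstein_coeff_unique:
  assumes "0 \<le> t"
    and c: "\<And>z. norm z < 1 \<Longrightarrow> (\<lambda>m. of_real (c m) * z ^ (k + m + 1)) sums Weinstein_gen k t z"
  shows "c m = Weinstein_poly k (k + m) t"
proof -
  let ?d = "\<lambda>n. if n < k + 1 then 0 else complex_of_real (c (n - (k + 1)))"
  have "Weinstein_gen k t has_fps_expansion Abs_fps ?d"
  proof (rule has_fps_expansionI)
    have "eventually (\<lambda>z::complex. z \<in> ball 0 1) (nhds 0)" by (intro eventually_nhds_in_open) auto
    then show "eventually (\<lambda>u. (\<lambda>n. Abs_fps ?d $ n * u ^ n) sums Weinstein_gen k t u) (nhds 0)"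
    proof eventually_elim
      case (elim u)
      then have "(\<lambda>m. Abs_fps ?d $ (m + (k + 1)) * u ^ (m + (k + 1))) sums Weinstein_gen k t u"
        using c[of u] by (simp add: add_ac)
      then show ?case
        by (subst (asm) sums_zero_iff_shift) auto
    qed
  qed
  then have "Abs_fps ?d = Abs_fps (\<lambda>m. case m of 0 \<Rightarrow> 0 | Suc n \<Rightarrow> of_real (Weinstein_poly k n t))"
    using Weinstein_gen_expansion[OF assms(1)] by (rule fps_expansion_unique_complex)
  then have "Abs_fps ?d $ (k + m + 1) = Abs_fps (\<lambda>m. case m of 0 \<Rightarrow> 0 | Suc n \<Rightarrow> of_real (Weinstein_poly k n t)) $ (k + m + 1)"
    by simp
  then show ?thesis by simp
qed

lemma Weinstein_eq_poly:
  assumes "k \<le> n" "0 \<le> t"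
  shows "Weinstein k n t = Weinstein_poly k n t"
proof -
  have "(THE c :: nat \<Rightarrow> real. \<forall>z\<in>ball (0::complex) 1.
       (\<lambda>m. of_real (c m) * z ^ (k + m + 1)) sums Weinstein_gen k t z) = (\<lambda>m. Weinstein_poly k (k + m) t)"
    by (rule the_equality) (use Weinstein_gen_sums Weinstein_coeff_unique assms in auto)
  then show ?thesis
    using assms unfolding Weinstein_def Weinstein_gen_def by simp
qed

text \<open>At t = 0 the flow is the identity, so uniqueness of coefficients evaluates the
  alternating binomial sum through z^(k+1) / (1 - z^2).\<close>

lemma Weinstein_poly_0:
  assumes "k \<le> n"
  shows "Weinstein_poly k n 0 = (if even (n - k) then 1 else 0)"
proof -
  have "(if even m then 1 else 0) = Weinstein_poly k (k + m) 0" for m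
  proof (rule Weinstein_coeff_unique)
    fix z :: complex
    assume z: "norm z < 1"
    have fl: "koebe_flow z 0 = z"
      unfolding koebe_flow_def using the_inv_into_f_f[OF koebe_inj_on, of z] z by simp
    \<comment> \<open>The coefficients 1, 0, 1, 0, ... arise as half the sum of the geometric series
      in z and -z.\<close>
    have "(\<lambda>m. z ^ (k + 1) / 2 * (z ^ m + (- z) ^ m)) sums (z ^ (k + 1) / 2 * (1 / (1 - z) + 1 / (1 - (- z))))"
      by (intro sums_mult sums_add geometric_sums) (use z in auto)
    moreover have "z ^ (k + 1) / 2 * (1 / (1 - z) + 1 / (1 - (- z))) = Weinstein_gen k 0 z"
    proof -
      have "z \<noteq> 1" "1 + z \<noteq> 0" using z by (auto simp: add_eq_0_iff)
      then have "1 / (1 - z) + 1 / (1 - (- z)) = 2 / (1 - z\<^sup>2)"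
        by (simp add: add_divide_eq_iff divide_add_eq_iff) (simp add: field_simps power2_eq_square)
      then show ?thesis by (simp add: Weinstein_gen_def fl)
    qed
    moreover have "z ^ (k + 1) / 2 * (z ^ m + (- z) ^ m) = of_real (if even m then 1 else 0) * z ^ (k + m + 1)" for m
      by (simp add: power_add)
    ultimately show "(\<lambda>m. of_real (if even m then 1 else 0) * z ^ (k + m + 1)) sums Weinstein_gen k 0 z"
      by (simp only:)
  qed simp
  from this[of "n - k"] show ?thesis using assms by simp
qed

section \<open>De Branges functions\<close>

text \<open>The primitive of \<open>- k * Weinstein_poly k n t\<close> that vanishes at infinity.\<close>
definition de_Branges_poly :: "nat \<Rightarrow> nat \<Rightarrow> real \<Rightarrow> real" where
  "de_Branges_poly n k t = real k * (\<Sum>j=k..n. (-1) ^ (k + j) * real ((2 * j) choose (j - k))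
              * real ((n + j + 1) choose (n - j)) / real j * exp (- (real j * t)))"

lemma de_Branges_poly_deriv:
  assumes "1 \<le> k"
  shows "(de_Branges_poly n k has_real_derivative - real k * Weinstein_poly k n t) (at t within A)"
proof -
  have "(de_Branges_poly n k has_real_derivative
     real k * (\<Sum>j=k..n. (-1) ^ (k + j) * real ((2 * j) choose (j - k))
              * real ((n + j + 1) choose (n - j)) / real j * (- real j * exp (- (real j * t))))) (at t within A)"
    unfolding de_Branges_poly_def [abs_def] using assms by (auto intro!: derivative_eq_intros sum.cong simp: mult_ac)
  also have "real k * (\<Sum>j=k..n. (-1) ^ (k + j) * real ((2 * j) choose (j - k))
              * real ((n + j + 1) choose (n - j)) / real j * (- real j * exp (- (real j * t)))) = - real k * Weinstein_poly k n t"
    unfolding Weinstein_poly_def sum_distrib_left using assms by (intro sum.cong refl) (auto simp: field_simps)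
  finally show ?thesis .
qed

text \<open>The differential system, with -k \<open>Weinstein_poly\<close> as derivative. For b_k =
  C(2j, j-k), the terms in e^(-jt) require (k+1) b_(k+1) + k b_k = j (b_k - b_(k+1)), that is,
  (j+k+1) b_(k+1) = (j-k) b_k.\<close>

lemma de_Branges_poly_step:
  assumes "1 \<le> k" "k \<le> n"
  shows "de_Branges_poly n (k + 1) t - de_Branges_poly n k t = - Weinstein_poly k n t - Weinstein_poly (k + 1) n t"
proof -
  \<comment> \<open>The value 0 below k lets the sums for k and k + 1 share one range.\<close>
  define b where "b = (\<lambda>k j. if j < k then 0 else real ((2 * j) choose (j - k)))"
  define e where "e = (\<lambda>j. (-1) ^ j * real ((n + j + 1) choose (n - j)) * exp (- (real j * t)))"
  have W: "Weinstein_poly l n t = (-1) ^ l * (\<Sum>j=k..n. b l j * e j)" if "k \<le> l" for l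
    unfolding Weinstein_poly_def sum_distrib_left
    by (rule sum.mono_neutral_cong_left) (use that in \<open>auto simp: b_def e_def power_add\<close>)
  have T: "de_Branges_poly n l t = (-1) ^ l * (\<Sum>j=k..n. real l * b l j / real j * e j)" if "k \<le> l" for l
    unfolding de_Branges_poly_def sum_distrib_left
    by (rule sum.mono_neutral_cong_left) (use that in \<open>auto simp: b_def e_def power_add\<close>)
  \<comment> \<open>An absorption identity; for j = k both sides are 0.\<close>
  have b: "real (j + k + 1) * b (k + 1) j = (real j - real k) * b k j" if "k \<le> j" for j
  proof (cases "j = k")
    case False
    with that have kj: "k < j" by simp
    have "Suc (j - k - 1) * (Suc (j - k - 1 + (j + k)) choose Suc (j - k - 1)) =
        Suc (j + k) * (Suc (j - k - 1 + (j + k)) choose (j - k - 1))"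
      by (rule Suc_times_binomial_add)
    moreover have "Suc (j - k - 1) = j - k" "Suc (j - k - 1 + (j + k)) = 2 * j" "j - k - 1 = j - (k + 1)" using kj by auto
    ultimately have "(j - k) * (2 * j choose (j - k)) = (j + k + 1) * (2 * j choose (j - (k + 1)))"
      by (simp only: Suc_eq_plus1)
    from arg_cong[OF this, of real] show ?thesis
      using kj unfolding of_nat_mult by (simp add: b_def of_nat_diff)
  qed (simp add: b_def)
  have "(\<Sum>j=k..n. real (k + 1) * b (k + 1) j / real j * e j) + (\<Sum>j=k..n. real k * b k j / real j * e j)
     = (\<Sum>j=k..n. b k j * e j) - (\<Sum>j=k..n. b (k + 1) j * e j)"
    unfolding sum.distrib[symmetric] sum_subtractf[symmetric]
  proof (intro sum.cong refl)
    fix j assume j: "j \<in> {k..n}"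
    have "real (k + 1) * b (k + 1) j + real k * b k j = real j * (b k j - b (k + 1) j)"
      using b[of j] j by (simp add: algebra_simps)
    then have "(real (k + 1) * b (k + 1) j + real k * b k j) / real j = b k j - b (k + 1) j"
      using j assms by (simp add: field_simps)
    then show "real (k + 1) * b (k + 1) j / real j * e j + real k * b k j / real j * e j = b k j * e j - b (k + 1) j * e j"
      by (metis add_divide_distrib distrib_right left_diff_distrib)
  qed
  then show ?thesis
    by (simp add: W T algebra_simps del: of_nat_Suc of_nat_add)
       (simp only: distrib_left[symmetric] minus_add_distrib[symmetric])
qed

text \<open>Descending induction from the empty sum at k = n + 1. Each step adds 1, because exactly
  one of n - k and n - k - 1 is even; for k = n the second term is an empty sum.\<close>

lemma de_Branges_poly_0:
  assumes "1 \<le> k" "k \<le> n + 1"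
  shows "de_Branges_poly n k 0 = real (n + 1 - k)"
  using assms(2,1)
proof (induction k rule: inc_induct)
  case base
  then show ?case by (simp add: de_Branges_poly_def)
next
  case (step k)
  have "Weinstein_poly k n 0 + Weinstein_poly (k + 1) n 0 = 1"
    using step.hyps Weinstein_poly_0[of k n] Weinstein_poly_0[of "k + 1" n]
    by (cases "k = n") (auto simp: Weinstein_poly_def[of "Suc n" n] even_diff_nat)
  moreover have "de_Branges_poly n (k + 1) 0 - de_Branges_poly n k 0 = - Weinstein_poly k n 0 - Weinstein_poly (k + 1) n 0"
    using step by (intro de_Branges_poly_step) auto
  ultimately show ?case using step by (simp add: of_nat_diff)
qed

lemma de_Branges_system_poly: "de_Branges_system n (de_Branges_poly n)"
proof -
  let ?T' = "\<lambda>k t. - real k * Weinstein_poly k n t"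
  have deriv: "(de_Branges_poly n k has_real_derivative ?T' k t) (at t within {0..})"
    if "k \<in> {1..n+1}" for k t
    using that by (intro de_Branges_poly_deriv) simp
  have step: "de_Branges_poly n (k + 1) t - de_Branges_poly n k t = ?T' k t / real k + ?T' (k + 1) t / real (k + 1)"
    if "k \<in> {1..n}" for k t
  proof -
    have cancel: "- real m * w / real m = - w" if "m \<noteq> 0" for m w
      using that by simp
    have "?T' k t / real k = - Weinstein_poly k n t"
      using that by (intro cancel) simp
    moreover have "?T' (k + 1) t / real (k + 1) = - Weinstein_poly (k + 1) n t"
      by (intro cancel) simp
    ultimately show ?thesis
      using de_Branges_poly_step[of k n t] that by simp
  qed
  have zero: "de_Branges_poly n (n + 1) t = 0" for t
    by (simp add: de_Branges_poly_def)
  have init: "de_Branges_poly n k 0 = real (n + 1 - k)" if "k \<in> {1..n+1}" for k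
    using that by (intro de_Branges_poly_0) auto
  show ?thesis
    unfolding de_Branges_system_def
    by (intro conjI exI[of _ ?T'] ballI deriv step zero init)
qed

section \<open>Uniqueness of the solution of the system\<close>

lemma DERIV_within_atLeast_unique:
  fixes f :: "real \<Rightarrow> real"
  assumes "(f has_real_derivative a) (at t within {0..})" "(f has_real_derivative b) (at t within {0..})" "0 \<le> t"
  shows "a = b"
proof -
  \<comment> \<open>A connected set with more than one point has no isolated point, so the one-sided
    derivative at 0 is unique too.\<close>
  have "{0..} \<noteq> {x}" for x :: real
    by (metis atLeast_iff order_refl singletonD zero_le_one zero_neq_one)
  then have "t islimpt {0..}"
    using assms(3) by (intro connected_imp_perfect) auto
  then have "at t within {0..} \<noteq> bot"
    by (simp add: trivial_limit_within)
  then show ?thesis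
    using assms(1,2) unfolding has_field_derivative_iff by (rule tendsto_unique)
qed

lemma de_Branges_system_unique:
  assumes \<sigma>: "de_Branges_system n \<sigma>" and \<tau>: "de_Branges_system n \<tau>"
    and k: "k \<in> {1..n+1}" and t: "0 \<le> t"
  shows "\<sigma> k t = \<tau> k t"
proof -
  obtain \<sigma>' where
    "\<forall>k\<in>{1..n+1}. \<forall>t\<in>{0..}. (\<sigma> k has_real_derivative \<sigma>' k t) (at t within {0..})"
    "\<forall>k\<in>{1..n}. \<forall>t\<in>{0..}. \<sigma> (k + 1) t - \<sigma> k t = \<sigma>' k t / real k + \<sigma>' (k + 1) t / real (k + 1)"
    using \<sigma> unfolding de_Branges_system_def by blast
  then have S: "\<And>k t. k \<in> {1..n+1} \<Longrightarrow> t \<ge> 0 \<Longrightarrow> (\<sigma> k has_real_derivative \<sigma>' k t) (at t within {0..})"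
    "\<And>k t. k \<in> {1..n} \<Longrightarrow> t \<ge> 0 \<Longrightarrow> \<sigma> (k + 1) t - \<sigma> k t = \<sigma>' k t / real k + \<sigma>' (k + 1) t / real (k + 1)"
    by blast+
  obtain \<tau>' where
    "\<forall>k\<in>{1..n+1}. \<forall>t\<in>{0..}. (\<tau> k has_real_derivative \<tau>' k t) (at t within {0..})"
    "\<forall>k\<in>{1..n}. \<forall>t\<in>{0..}. \<tau> (k + 1) t - \<tau> k t = \<tau>' k t / real k + \<tau>' (k + 1) t / real (k + 1)"
    using \<tau> unfolding de_Branges_system_def by blast
  then have T: "\<And>k t. k \<in> {1..n+1} \<Longrightarrow> t \<ge> 0 \<Longrightarrow> (\<tau> k has_real_derivative \<tau>' k t) (at t within {0..})"
    "\<And>k t. k \<in> {1..n} \<Longrightarrow> t \<ge> 0 \<Longrightarrow> \<tau> (k + 1) t - \<tau> k t = \<tau>' k t / real k + \<tau>' (k + 1) t / real (k + 1)"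
    by blast+
  define d where "d = (\<lambda>k t. \<sigma> k t - \<tau> k t)"
  define d' where "d' = (\<lambda>k t. \<sigma>' k t - \<tau>' k t)"
  have D: "(d k has_real_derivative d' k t) (at t within {0..})" if "k \<in> {1..n+1}" "t \<ge> 0" for k t
    unfolding d_def d'_def by (intro DERIV_diff S T that)
  have rec: "d (k + 1) t - d k t = d' k t / real k + d' (k + 1) t / real (k + 1)" if "k \<in> {1..n}" "t \<ge> 0" for k t
    using S(2)[OF that] T(2)[OF that] unfolding d_def d'_def diff_divide_distrib by linarith
  have d0: "d k 0 = 0" if "k \<in> {1..n+1}" for k
    using \<sigma> \<tau> that unfolding d_def de_Branges_system_def by auto
  have "k \<le> n + 1" using k by auto
  then have "1 \<le> k \<longrightarrow> (\<forall>t\<ge>0. d k t = 0)"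
  proof (induction k rule: inc_induct)
    case base
    then show ?case using \<sigma> \<tau> unfolding d_def de_Branges_system_def by auto
  next
    case (step k)
    show ?case
    proof (intro impI allI)
      fix t :: real
      assume k: "1 \<le> k" and t: "0 \<le> t"
      have z: "d (k + 1) s = 0" if "s \<ge> 0" for s using step.IH that by auto
      \<comment> \<open>\<open>d'\<close> is only a witness from the system; uniqueness of
        derivatives forces it to be 0 where \<open>d\<close> vanishes identically.\<close>
      have "d' (k + 1) s = 0" if "s \<ge> 0" for s
      proof (rule DERIV_within_atLeast_unique)
        show "(d (k + 1) has_real_derivative d' (k + 1) s) (at s within {0..})"
          using step.hyps that by (intro D) auto
        show "(d (k + 1) has_real_derivative 0) (at s within {0..})"
          by (rule has_field_derivative_transform_within[of "\<lambda>_. 0", OF _ zero_less_one]) (use z that in auto)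
      qed (use that in auto)
      then have d': "d' k s = - real k * d k s" if "s \<ge> 0" for s
        using rec[of k s] z[of s] that k step.hyps by (simp add: field_simps)
      \<comment> \<open>Integrating factor for d' = -k d: the product is constant and vanishes at
        0.\<close>
      have "((\<lambda>s. exp (real k * s) * d k s) has_real_derivative 0) (at s within {0..})" if "s \<ge> 0" for s
      proof -
        have "(d k has_real_derivative - real k * d k s) (at s within {0..})"
          using D[of k s] d'[OF that] k step.hyps that by simp
        then show ?thesis by (auto intro!: derivative_eq_intros)
      qed
      then obtain c where "\<And>s. s \<in> {0..} \<Longrightarrow> exp (real k * s) * d k s = c"
        using has_field_derivative_zero_constant[of "{0..}" "\<lambda>s. exp (real k * s) * d k s"] by auto
      from this[of t] this[of 0] show "d k t = 0"
        using t d0[of k] k step.hyps by simp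
    qed
  qed
  then show ?thesis using k t by (simp add: d_def)
qed

text \<open>The system sees only indices 1, ..., n + 1 and nonnegative times, so the closed form may
  be replaced by its extensional restriction.\<close>

lemma de_Branges_system_cong:
  assumes "de_Branges_system n \<tau>" "\<And>k t. k \<in> {1..n+1} \<Longrightarrow> t \<ge> 0 \<Longrightarrow> \<sigma> k t = \<tau> k t"
  shows "de_Branges_system n \<sigma>"
proof -
  have "(\<sigma> k has_real_derivative D) (at t within {0..})"
    if "(\<tau> k has_real_derivative D) (at t within {0..})" "k \<in> {1..n+1}" "t \<ge> 0" for k t D
    by (rule has_field_derivative_transform_within[OF that(1) zero_less_one]) (use that assms(2) in auto)
  moreover obtain \<tau>' where
    "\<forall>k\<in>{1..n+1}. \<forall>t\<in>{0..}. (\<tau> k has_real_derivative \<tau>' k t) (at t within {0..})"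
    "\<forall>k\<in>{1..n}. \<forall>t\<in>{0..}. \<tau> (k + 1) t - \<tau> k t = \<tau>' k t / real k + \<tau>' (k + 1) t / real (k + 1)"
    and "\<forall>t\<in>{0..}. \<tau> (n + 1) t = 0" "\<forall>k\<in>{1..n+1}. \<tau> k 0 = real (n + 1 - k)"
    using assms(1) unfolding de_Branges_system_def by blast
  ultimately show ?thesis
    unfolding de_Branges_system_def
    by (intro conjI exI[of _ \<tau>']) (simp_all add: assms(2))
qed

lemma de_Branges_eq_poly:
  assumes "k \<in> {1..n+1}" "0 \<le> t"
  shows "de_Branges n k t = de_Branges_poly n k t"
proof -
  define T where "T = (\<lambda>k\<in>{1..n+1}. \<lambda>t\<in>{0..}. de_Branges_poly n k t)"
  have sys: "de_Branges_system n T"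
    by (rule de_Branges_system_cong[OF de_Branges_system_poly]) (auto simp: T_def)
  have "de_Branges n = T"
    unfolding de_Branges_def
  proof (rule the_equality)
    show "T \<in> {1..n+1} \<rightarrow>\<^sub>E ({0..} \<rightarrow>\<^sub>E UNIV) \<and> de_Branges_system n T"
      using sys by (auto simp: T_def)
  next
    fix \<tau> assume \<tau>: "\<tau> \<in> {1..n+1} \<rightarrow>\<^sub>E ({0..} \<rightarrow>\<^sub>E UNIV) \<and> de_Branges_system n \<tau>"
    show "\<tau> = T"
    \<comment> \<open>Extensionality in the index, and below in the time, reduces the claim to
      uniqueness of values.\<close>
    proof (rule PiE_ext[of \<tau> "{1..n+1}" "\<lambda>_. {0..} \<rightarrow>\<^sub>E UNIV"])
      show "\<tau> \<in> {1..n+1} \<rightarrow>\<^sub>E ({0..} \<rightarrow>\<^sub>E UNIV)" using \<tau> ..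
      show T: "T \<in> {1..n+1} \<rightarrow>\<^sub>E ({0..} \<rightarrow>\<^sub>E UNIV)" by (auto simp: T_def)
      fix k assume k: "k \<in> {1..n+1}"
      show "\<tau> k = T k"
      proof (rule PiE_ext[of _ "{0..}" "\<lambda>_. UNIV"])
        show "\<tau> k \<in> {0..} \<rightarrow>\<^sub>E UNIV" using \<tau> k by (blast dest: PiE_mem)
        show "T k \<in> {0..} \<rightarrow>\<^sub>E UNIV" using T k by (blast dest: PiE_mem)
        show "\<tau> k t = T k t" if "t \<in> {0..}" for t
          using de_Branges_system_unique[of n \<tau> T k t] \<tau> sys k that by auto
      qed
    qed
  qed
  then show ?thesis using assms by (simp add: T_def)
qed

theorem mainTheorem2:
  fixes n k :: nat and t :: real
  assumes "1 \<le> k" and "k \<le> n" and "0 \<le> t"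
  shows "Weinstein k n t =
           (\<Sum>j=k..n. (-1) ^ (k + j) * real ((2 * j) choose (j - k))
              * real ((n + j + 1) choose (n - j)) * exp (- (real j * t))) \<and>
         (de_Branges n k has_real_derivative
           - real k * (\<Sum>j=k..n. (-1) ^ (k + j) * real ((2 * j) choose (j - k))
              * real ((n + j + 1) choose (n - j)) * exp (- (real j * t))))
         (at t within {0..})"
proof -
  \<comment> \<open>Only values on the half-line matter, and there both functions agree; the radius
    1 is arbitrary.\<close>
  have "(de_Branges n k has_real_derivative - real k * Weinstein_poly k n t) (at t within {0..})"
    by (rule has_field_derivative_transform_within[OF de_Branges_poly_deriv[OF assms(1)] zero_less_one])
       (use assms de_Branges_eq_poly in auto)
  then show ?thesis
    using Weinstein_eq_poly assms unfolding Weinstein_poly_def by auto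
qed

end
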